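(* Let $\mathcal{J}=\arg\min_{1\le j\le k+1}\lambda_j/\lambda_{n-k+j-1}$, let $j_0\in\mathcal{J}$, and let $\pi_k\in\Pi_k$ be such that $\bar\pi_k=\{j_0,j_0+1,\dots,j_0+n-k-1\}$. Then $\pi_k\in\arg\min_{\pi_k'\in\Pi_k}\kappa_{\bar\pi_k'}$.
   Context: $\lambda_1\ge\dots\ge\lambda_n>0$ are the eigenvalues of a symmetric positive definite matrix $A\in\mathbb{R}^{n\times n}$, and $k$ is an integer with $1<k<n$. $\Pi_k=\{\pi_k\subset\{1,\dots,n\}: |\pi_k|=k\}$; $\bar\pi_k$ denotes the complement of $\pi_k$ in $\{1,\dots,n\}$; and $\kappa_{\bar\pi_k}:=\max_{i\in\bar\pi_k}\lambda_i/\min_{i\in\bar\pi_k}\lambda_i$. *)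

theory Defs
  imports "Jordan_Normal_Form.Char_Poly"
begin

definition spd_mat :: "nat \<Rightarrow> real mat \<Rightarrow> bool" where
  "spd_mat n A \<longleftrightarrow> A \<in> carrier_mat n n \<and> transpose_mat A = A \<and>
     (\<forall>v \<in> carrier_vec n. v \<noteq> 0\<^sub>v n \<longrightarrow> v \<bullet> (A *\<^sub>v v) > 0)"

(* The eigenvalues are indexed by 1, ..., n and repeated according to multiplicity;
   values of lam outside {1..n} are irrelevant. *)
definition ordered_eigenvalues :: "nat \<Rightarrow> real mat \<Rightarrow> (nat \<Rightarrow> real) \<Rightarrow> bool" where
  "ordered_eigenvalues n A lam \<longleftrightarrow>
     char_poly A = (\<Prod>i\<in>{1..n}. [:- lam i, 1:]) \<and> antimono_on {1..n} lam"

definition Pi_sets :: "nat \<Rightarrow> nat \<Rightarrow> nat set set" where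
  "Pi_sets n k = {p. p \<subseteq> {1..n} \<and> card p = k}"

(* Meant for finite nonempty S. *)
definition kappa :: "(nat \<Rightarrow> real) \<Rightarrow> nat set \<Rightarrow> real" where
  "kappa lam S = Max (lam ` S) / Min (lam ` S)"

end

theory Submission
  imports Defs
begin

text \<open>
  Since the eigenvalues decrease in their index, \<open>kappa lam S\<close> is the ratio of the eigenvalue at
  the least index \<open>a\<close> of \<open>S\<close> to the one at the greatest index \<open>b\<close>.
  If \<open>S\<close> has \<open>m\<close> elements then \<open>b \<ge> a + m - 1\<close>, so replacing \<open>S\<close> by the block of \<open>m\<close> consecutive
  indices that starts at \<open>a\<close> does not decrease the denominator (lemma \<open>kappa_ge_block\<close>). Hence the
  minimum over all \<open>m\<close>-element sets is attained on a block, and the blocks inside \<open>{1..n}\<close>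
  are exactly the ones that start at some \<open>j \<le> n - m + 1\<close>; with \<open>m = n - k\<close> these are the
  competitors in the definition of \<open>J\<close>. Positive definiteness makes the eigenvalues positive
  (lemma \<open>spd_eigenvalue_pos\<close>), so a larger denominator does give a smaller ratio.
\<close>

text \<open>
  An eigenvector \<open>v\<close> turns positivity of the quadratic form into \<open>0 < v \<bullet> (A v) = x (v \<bullet> v)\<close>.
\<close>
lemma spd_eigenvalue_pos:
  assumes A: "spd_mat n A" and root: "poly (char_poly A) x = 0"
  shows "x > 0"
proof -
  have carr: "A \<in> carrier_mat n n" using A by (simp add: spd_mat_def)
  then obtain v where v: "v \<in> carrier_vec n" "v \<noteq> 0\<^sub>v n" "A *\<^sub>v v = x \<cdot>\<^sub>v v"
    using root eigenvalue_root_char_poly[OF carr, of x]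
    by (auto simp: eigenvalue_def eigenvector_def)
  have "v \<bullet> (A *\<^sub>v v) > 0" using A v by (auto simp: spd_mat_def)
  then have "x * (v \<bullet> v) > 0" using v by simp
  moreover have "v \<bullet> v \<ge> 0" by (simp add: scalar_prod_def sum_nonneg)
  ultimately show ?thesis by (simp add: zero_less_mult_iff)
qed

lemma ordered_eigenvalues_pos:
  assumes "spd_mat n A" "ordered_eigenvalues n A lam" "i \<in> {1..n}"
  shows "lam i > 0"
proof -
  have "poly (char_poly A) (lam i) = 0"
    using assms(2,3) by (auto simp: ordered_eigenvalues_def poly_prod)
  then show ?thesis by (rule spd_eigenvalue_pos[OF assms(1)])
qed

lemma kappa_antimono_on:
  assumes "antimono_on S lam" "finite S" "S \<noteq> {}"
  shows "kappa lam S = lam (Min S) / lam (Max S)"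
proof -
  have "Min S \<in> S" "Max S \<in> S" using assms(2,3) by simp_all
  then have bounds: "lam x \<le> lam (Min S)" "lam (Max S) \<le> lam x" if "x \<in> S" for x
    using assms(1,2) that by (auto intro: monotone_onD[OF assms(1)])
  have "Max (lam ` S) = lam (Min S)"
    using assms bounds by (intro Max_eqI) auto
  moreover have "Min (lam ` S) = lam (Max S)"
    using assms bounds by (intro Min_eqI) auto
  ultimately show ?thesis by (simp add: kappa_def)
qed

lemma Min_plus_card_le_Suc_Max:
  fixes S :: "nat set"
  assumes "finite S" "S \<noteq> {}"
  shows "Min S + card S \<le> Suc (Max S)"
proof -
  have "card S \<le> card {Min S..Max S}"
    using assms by (intro card_mono) auto
  moreover have "Min S \<le> Max S" using assms by simp
  ultimately show ?thesis by simp
qed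

text \<open>
  Sliding the greatest index of \<open>S\<close> down to the end of the block that starts at \<open>Min S\<close> and has as
  many elements as \<open>S\<close> does not decrease the denominator.
\<close>
lemma kappa_ge_block:
  assumes anti: "antimono_on {1..n} lam" and pos: "\<And>i. i \<in> {1..n} \<Longrightarrow> lam i > 0"
    and S: "S \<subseteq> {1..n}" "S \<noteq> {}"
  shows "lam (Min S) / lam (card S + Min S - 1) \<le> kappa lam S"
proof -
  have fin: "finite S" using S(1) finite_subset by blast
  have mem: "Min S \<in> {1..n}" "Max S \<in> {1..n}"
    using S fin Min_in Max_in by blast+
  have "card S > 0" using fin S(2) by (simp add: card_gt_0_iff)
  then have "card S + Min S - 1 \<in> {1..n}" "card S + Min S - 1 \<le> Max S"
    using Min_plus_card_le_Suc_Max[OF fin S(2)] mem by auto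
  then have "lam (Max S) \<le> lam (card S + Min S - 1)"
    using anti mem by (auto simp: monotone_on_def)
  moreover have "kappa lam S = lam (Min S) / lam (Max S)"
    using monotone_on_subset[OF anti S(1)] fin S(2) by (rule kappa_antimono_on)
  ultimately show ?thesis
    using pos[OF mem(1)] pos[OF mem(2)] by (simp add: frac_le)
qed

theorem proposition3p7:
  fixes A :: "real mat" and n k :: nat and lam :: "nat \<Rightarrow> real"
    and J :: "nat set" and j0 :: nat and p :: "nat set"
  assumes "spd_mat n A"
    and "ordered_eigenvalues n A lam"
    and "1 < k" and "k < n"
    and "J = {j. is_arg_min (\<lambda>j. lam j / lam (n - k + j - 1)) (\<lambda>j. 1 \<le> j \<and> j \<le> k + 1) j}"
    and "j0 \<in> J"
    and "p \<in> Pi_sets n k"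
    and "{1..n} - p = {j0..j0 + n - k - 1}"
  shows "is_arg_min (\<lambda>q. kappa lam ({1..n} - q)) (\<lambda>q. q \<in> Pi_sets n k) p"
proof -
  let ?r = "\<lambda>j. lam j / lam (n - k + j - 1)"
  have anti: "antimono_on {1..n} lam"
    using assms(2) by (simp add: ordered_eigenvalues_def)
  have pos: "\<And>i. i \<in> {1..n} \<Longrightarrow> lam i > 0"
    using ordered_eigenvalues_pos[OF assms(1,2)] .
  have j0_min: "?r j0 \<le> ?r j" if "1 \<le> j" "j \<le> k + 1" for j
    using assms(5,6) that by (auto simp: is_arg_min_linorder)
  have p_val: "kappa lam ({1..n} - p) = ?r j0"
  proof -
    define b where "b = j0 + n - k - 1"
    have b: "j0 \<le> b" "b = n - k + j0 - 1" using \<open>k < n\<close> by (auto simp: b_def)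
    have eq: "{1..n} - p = {j0..b}" using assms(8) by (simp add: b_def)
    have "antimono_on {j0..b} lam"
      using monotone_on_subset[OF anti, of "{1..n} - p"] eq by auto
    then have "kappa lam {j0..b} = lam (Min {j0..b}) / lam (Max {j0..b})"
      using b(1) by (intro kappa_antimono_on) auto
    moreover have "Min {j0..b} = j0" "Max {j0..b} = b"
      using b(1) by (auto intro: Min_eqI Max_eqI)
    ultimately show ?thesis using eq b(2) by simp
  qed
  have "kappa lam ({1..n} - p) \<le> kappa lam ({1..n} - q)" if q: "q \<in> Pi_sets n k" for q
  proof -
    let ?S = "{1..n} - q"
    have card: "card ?S = n - k"
      using q by (auto simp: Pi_sets_def card_Diff_subset finite_subset)
    then have ne: "?S \<noteq> {}" using \<open>k < n\<close> by (metis card.empty zero_less_diff less_irrefl)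
    have mem: "Min ?S \<in> ?S" "Max ?S \<in> ?S" using ne by (intro Min_in Max_in; simp)+
    \<comment> \<open>There must be room for \<open>n - k\<close> indices between the least index and \<open>n\<close>.\<close>
    have "Min ?S \<le> k + 1"
    proof -
      have "Min ?S + card ?S \<le> Suc (Max ?S)" using ne by (intro Min_plus_card_le_Suc_Max) auto
      moreover have "Max ?S \<le> n" using mem(2) by (meson DiffD1 atLeastAtMost_iff)
      ultimately show ?thesis using card \<open>k < n\<close> by linarith
    qed
    then have "?r j0 \<le> ?r (Min ?S)" using mem(1) by (intro j0_min) auto
    also have "\<dots> \<le> kappa lam ?S"
      using kappa_ge_block[OF anti pos _ ne] card by simp
    finally show ?thesis using p_val by simp
  qed
  then show ?thesis using assms(7) by (auto simp: is_arg_min_linorder)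
qed

end
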